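(* Let $\{z^k\}$ be generated by the SRPA algorithm. For every $\epsilon>0$ there exists $k\le\bar k(\epsilon)$, where $$\bar k(\epsilon)=\left\lceil \kappa_1+6\gamma^2\eta_1^{-1}\rho_1^{-1}\big(\Theta(z^1)-\Theta^*\big)\epsilon^{-2}\right\rceil,$$ such that $z^k$ is an $\epsilon$-approximate d-stationary point of the problem $\min_z\Theta(z)$. Here $$\kappa_1=\left[\left\lceil\log_{\eta_2}\!\left(\frac{\bar K_F+\sqrt J\,\bar K_c}{\rho_1(1-\eta_1)}\right)\right\rceil\right]_+ +1$$ and $$\gamma=\max\left\{\frac{2(\Theta(z^1)-\Theta^* )}{\big(\sqrt{2\rho_1^{-1}\Theta(z^1)}+2\rho_1^{-1}K_F\big)^2},\ \frac{8(\Theta(z^1)-\Theta^* )}{\delta^2},\ \rho_1\eta_2+2(\bar K_F+\sqrt J\bar K_c),\ \Big(\frac{\eta_2^2}{1-\eta_1}+2\Big)(\bar K_F+\sqrt J\bar K_c),\ 1\right\}.$$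
   Context: Setting. Let $L,n,N_1,\dots,N_L$ be positive integers, $\bar N_0=0$, $\bar N_\ell=\sum_{j=1}^{\ell}N_j$, $\bar N=n+\bar N_L$. Write $z=(\theta^\top,u_1^\top,\dots,u_L^\top)^\top\in\mathbb{R}^{\bar N}$, $\theta\in\mathbb{R}^n$, $u_\ell\in\mathbb{R}^{N_\ell}$, $u=(u_1^\top,\dots,u_L^\top)^\top$. Let $g:\mathbb{R}^{\bar N_L}\to\mathbb{R}_+$ and $\psi_{\ell-1}:\mathbb{R}^{n+\bar N_{\ell-1}}\to\mathbb{R}^{N_\ell}$ be locally Lipschitz and twice directionally differentiable (i.e. the limits $f'(x;d)=\lim_{\tau\downarrow0}\frac{f(x+\tau d)-f(x)}{\tau}$ and $f^{(2)}(x;d)=\lim_{\tau\downarrow0}\frac{f(x+\tau d)-f(x)-\tau f'(x;d)}{\tau^2/2}$ exist for all $x,d$), $\lambda>0$, $\beta_\ell>0$, and $$F(z)=g(u)+\lambda\|\theta\|^2,\quad \Theta(z)=F(z)+\sum_{\ell=1}^L\beta_\ell\|u_\ell-\psi_{\ell-1}(\theta,u_1,\dots,u_{\ell-1})\|_1 .$$ "Smooth" means differentiable with locally Lipschitz gradient. A function is piecewise affine if its domain is a finite union of polyhedral sets on each of which it is affine. Assume moreover that $g$ is smooth and every component of every $\psi_{\ell-1}$ is either smooth or piecewise affine. Then $\Theta$ is written as $\Theta(z)=F(z)+H(z)+\sum_{j\in\mathcal J}|c_j(z)|$ with $H:\mathbb{R}^{\bar N}\to\mathbb{R}_+$ continuous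 piecewise affine, $c_j:\mathbb{R}^{\bar N}\to\mathbb{R}$ smooth, $\mathcal J=\{1,\dots,J\}$, $0\le J\le\bar N_L$ (components with piecewise affine $\psi$ are collected in $H$, the others in the $c_j$); fix this decomposition, and set $c=(c_1,\dots,c_J)^\top$, $\nabla c$ = transposed Jacobian. Fix finitely many nonempty, mutually distinct polyhedra $P_1,\dots,P_I$ with $\bigcup_{i\in[I]}P_i=\mathbb{R}^{\bar N}$ such that $H$ is affine on each $P_i$. The function $\Theta$ is level-bounded and $\Theta^*=\min_z\Theta(z)$ is finite. Notation: $\|\cdot\|$ Euclidean (spectral for matrices) norm; $\mathbf d(z,P)=\inf_{y\in P}\|z-y\|$; $\mathbb B(z;r)$ closed ball; $[a]_+=\max\{a,0\}$; $\mathrm{lev}_{\le\gamma}\Theta=\{z:\Theta(z)\le\gamma\}$; $\mathcal A^\delta(z)=\{i\in[I]:\mathbf d(z,P_i)\le\delta\}$. SRPA algorithm. Input: $z^1\in\mathbb{R}^{\bar N}$, $\rho_1>0$, $\eta_1\in(0,1)$, $\eta_2>1$, $\delta>0$. For $k=1,2,\dots$: with $$\Phi_k(s)=F(z^k)+\nabla F(z^k)^\top s+H(z^k+s)+\sum_{j\in\mathcal J}|c_j(z^k)+\nabla c_j(z^k)^\top s|+\frac{\rho_k}{2}\|s\|^2,$$ for each $i\in\mathcal A^\delta(z^k)$ let $s^{k,i}$ be the minimizer of $\Phi_k$ over $\{z-z^k:z\in P_i\}$; let $s^k$ be one of the $s^{k,i}$, $i\in\mathcal A^\delta(z^k)$,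 with the smallest value of $\Phi_k$. If $\Phi_k(s^k)=\Phi_k(\mathbf 0)$, terminate and output $z^k$. Otherwise, set $(z^{k+1},\rho_{k+1})=(z^k+s^k,\rho_k)$ if $\Theta(z^k)-\Theta(z^k+s^k)\ge\frac{\eta_1\rho_k}{2}\|s^k\|^2$, and $(z^{k+1},\rho_{k+1})=(z^k,\eta_2\rho_k)$ otherwise. Constants: $K_F>0$ satisfies $\|\nabla F(z)\|\le K_F$ for all $z\in\mathrm{lev}_{\le\Theta(z^1)}\Theta$; $\bar K_F,\bar K_c>0$ satisfy $\|\nabla F(z)-\nabla F(y)\|\le\bar K_F\|z-y\|$ and $\|\nabla c(z)-\nabla c(y)\|\le\bar K_c\|z-y\|$ for all $z,y\in\mathrm{lev}_{\le\Theta(z^1)}\Theta+\mathbb B\big(\mathbf 0;2\rho_1^{-1}K_F+\sqrt{2\rho_1^{-1}\Theta(z^1)}\big)$. Definition: $z$ is an $\epsilon$-approximate d-stationary point if there is $y\in\mathbb B(z;\epsilon)$ with $\Theta'(y;d)\ge-\epsilon$ for all $d$ with $\|d\|=1$. *)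

theory Defs
  imports "HOL-Analysis.Analysis"
begin

section \<open>Regularity notions\<close>

definition locally_lipschitz :: "('a::metric_space \<Rightarrow> 'b::metric_space) \<Rightarrow> bool" where
  "locally_lipschitz f \<longleftrightarrow> (\<forall>x. \<exists>e>0. \<exists>K. K-lipschitz_on (ball x e) f)"

definition has_dir_deriv :: "('a::real_normed_vector \<Rightarrow> real) \<Rightarrow> 'a \<Rightarrow> 'a \<Rightarrow> real \<Rightarrow> bool" where
  "has_dir_deriv f x d D \<longleftrightarrow> ((\<lambda>t. (f (x + t *\<^sub>R d) - f x) / t) \<longlongrightarrow> D) (at_right 0)"

definition twice_dir_differentiable :: "('a::real_normed_vector \<Rightarrow> real) \<Rightarrow> bool" where
  "twice_dir_differentiable f \<longleftrightarrow>
     (\<forall>x d. \<exists>D D2. has_dir_deriv f x d D \<and>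
        ((\<lambda>t. (f (x + t *\<^sub>R d) - f x - t * D) / (t\<^sup>2 / 2)) \<longlongrightarrow> D2) (at_right 0))"

text \<open>The gradient; only meaningful where \<open>f\<close> is differentiable.\<close>

definition grad :: "('a::real_inner \<Rightarrow> real) \<Rightarrow> 'a \<Rightarrow> 'a" where
  "grad f x = (THE D. GDERIV f x :> D)"

definition smooth_fun :: "('a::real_inner \<Rightarrow> real) \<Rightarrow> bool" where
  "smooth_fun f \<longleftrightarrow> (\<forall>x. \<exists>D. GDERIV f x :> D) \<and> locally_lipschitz (grad f)"

definition affine_fun_on :: "'a::real_inner set \<Rightarrow> ('a \<Rightarrow> real) \<Rightarrow> bool" where
  "affine_fun_on S f \<longleftrightarrow> (\<exists>a b. \<forall>x\<in>S. f x = a \<bullet> x + b)"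

definition piecewise_affine :: "('a::euclidean_space \<Rightarrow> real) \<Rightarrow> bool" where
  "piecewise_affine f \<longleftrightarrow>
     (\<exists>\<P>. finite \<P> \<and> \<Union>\<P> = UNIV \<and> (\<forall>P\<in>\<P>. polyhedron P \<and> affine_fun_on P f))"

section \<open>The penalized problem\<close>

text \<open>
  A point is a pair \<open>z = (\<theta>, u)\<close>, where \<open>u :: real^'m\<close> stacks the blocks \<open>u_1, ..., u_L\<close>.
  The map \<open>lay :: 'm \<Rightarrow> nat\<close> sends a coordinate of \<open>u\<close> to the number of its block, so that
  \<open>N_l = card {i. lay i = l}\<close> and \<open>CARD('m) = N_1 + ... + N_L\<close>.
  For \<open>lay i = l\<close>, the function \<open>\<psi> i\<close> is the component of \<open>\<psi>_(l-1)\<close> belonging to coordinate \<open>i\<close>,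
  regarded as a function of the whole of \<open>z\<close> that ignores the blocks \<open>u_l, ..., u_L\<close>.
\<close>

definition obj_F :: "(real^'m \<Rightarrow> real) \<Rightarrow> real \<Rightarrow> (real^'n) \<times> (real^'m) \<Rightarrow> real" where
  "obj_F g lam z = g (snd z) + lam * (norm (fst z))\<^sup>2"

definition obj_Theta ::
  "nat \<Rightarrow> ('m \<Rightarrow> nat) \<Rightarrow> (nat \<Rightarrow> real) \<Rightarrow> ('m \<Rightarrow> (real^'n) \<times> (real^'m) \<Rightarrow> real)
    \<Rightarrow> ((real^'n) \<times> (real^'m) \<Rightarrow> real) \<Rightarrow> (real^'n) \<times> (real^'m) \<Rightarrow> real" where
  "obj_Theta L lay \<beta> \<psi> F z =
     F z + (\<Sum>l=1..L. \<beta> l * (\<Sum>i | lay i = l. \<bar>snd z $ i - \<psi> i z\<bar>))"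

definition part_H ::
  "('m \<Rightarrow> nat) \<Rightarrow> (nat \<Rightarrow> real) \<Rightarrow> ('m \<Rightarrow> (real^'n) \<times> (real^'m) \<Rightarrow> real)
    \<Rightarrow> (real^'n) \<times> (real^'m) \<Rightarrow> real" where
  "part_H lay \<beta> \<psi> z =
     (\<Sum>i | piecewise_affine (\<psi> i). \<beta> (lay i) * \<bar>snd z $ i - \<psi> i z\<bar>)"

text \<open>
  The functions \<open>c_j\<close> are indexed by the coordinates whose \<open>\<psi>\<close> is not piecewise affine instead of
  by \<open>{1..J}\<close>; thus \<open>J\<close> is the cardinality of \<open>idx_J \<psi>\<close> and may be \<open>0\<close>.
\<close>

definition idx_J :: "('m \<Rightarrow> (real^'n) \<times> (real^'m) \<Rightarrow> real) \<Rightarrow> 'm set" where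
  "idx_J \<psi> = {i. \<not> piecewise_affine (\<psi> i)}"

definition part_c ::
  "('m \<Rightarrow> nat) \<Rightarrow> (nat \<Rightarrow> real) \<Rightarrow> ('m \<Rightarrow> (real^'n) \<times> (real^'m) \<Rightarrow> real)
    \<Rightarrow> 'm \<Rightarrow> (real^'n) \<times> (real^'m) \<Rightarrow> real" where
  "part_c lay \<beta> \<psi> j z = \<beta> (lay j) * (snd z $ j - \<psi> j z)"

text \<open>
  The transposed Jacobian of \<open>(c_j)\<close>, \<open>j \<in> \<J>\<close>, as the linear map \<open>w \<mapsto> \<Sum>j. w_j \<nabla>c_j(z)\<close>.
  It is padded with zero columns for the coordinates outside \<open>\<J>\<close>, which does not affect
  spectral norms.
\<close>

definition jac_T :: "'m set \<Rightarrow> ('m \<Rightarrow> 'a::real_inner \<Rightarrow> real) \<Rightarrow> 'a \<Rightarrow> real^'m \<Rightarrow> 'a" where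
  "jac_T \<J> c z w = (\<Sum>j\<in>\<J>. (w $ j) *\<^sub>R grad (c j) z)"

definition approx_d_stationary :: "('a::real_normed_vector \<Rightarrow> real) \<Rightarrow> real \<Rightarrow> 'a \<Rightarrow> bool" where
  "approx_d_stationary \<Theta> \<epsilon> z \<longleftrightarrow>
     (\<exists>y\<in>cball z \<epsilon>. \<forall>d. norm d = 1 \<longrightarrow> (\<exists>D. has_dir_deriv \<Theta> y d D \<and> D \<ge> - \<epsilon>))"

section \<open>The SRPA algorithm\<close>

definition model_Phi ::
  "('a::real_inner \<Rightarrow> real) \<Rightarrow> ('a \<Rightarrow> real) \<Rightarrow> 'm set \<Rightarrow> ('m \<Rightarrow> 'a \<Rightarrow> real) \<Rightarrow> 'a \<Rightarrow> real \<Rightarrow> 'a \<Rightarrow> real"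
  where
  "model_Phi F H \<J> c z \<rho> s =
     F z + grad F z \<bullet> s + H (z + s) + (\<Sum>j\<in>\<J>. \<bar>c j z + grad (c j) z \<bullet> s\<bar>) + \<rho> / 2 * (norm s)\<^sup>2"

definition active :: "nat \<Rightarrow> (nat \<Rightarrow> 'a::metric_space set) \<Rightarrow> real \<Rightarrow> 'a \<Rightarrow> nat set" where
  "active I P \<delta> z = {i\<in>{1..I}. infdist z (P i) \<le> \<delta>}"

text \<open>
  Runs start at index \<open>1\<close>. The argument \<open>T\<close> is the index at which the algorithm terminates
  (\<open>\<infinity>\<close> if it does not), so that exactly the iterates \<open>z k\<close> with \<open>1 \<le> k \<le> T\<close> are generated; other
  values of the sequences are unconstrained.
\<close>

definition srpa_run ::
  "('a::euclidean_space \<Rightarrow> real) \<Rightarrow> ('a \<Rightarrow> real) \<Rightarrow> ('a \<Rightarrow> real) \<Rightarrow> 'm set \<Rightarrow> ('m \<Rightarrow> 'a \<Rightarrow> real)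
    \<Rightarrow> nat \<Rightarrow> (nat \<Rightarrow> 'a set) \<Rightarrow> real \<Rightarrow> real \<Rightarrow> real
    \<Rightarrow> (nat \<Rightarrow> 'a) \<Rightarrow> (nat \<Rightarrow> real) \<Rightarrow> (nat \<Rightarrow> nat \<Rightarrow> 'a) \<Rightarrow> (nat \<Rightarrow> 'a) \<Rightarrow> enat \<Rightarrow> bool" where
  "srpa_run \<Theta> F H \<J> c I P \<eta>1 \<eta>2 \<delta> z \<rho> ss s T \<longleftrightarrow>
     1 \<le> T \<and>
     (\<forall>k\<ge>1. enat k \<le> T \<longrightarrow>
       (let \<Phi> = model_Phi F H \<J> c (z k) (\<rho> k); A = active I P \<delta> (z k) in
         (\<forall>i\<in>A. is_arg_min \<Phi> (\<lambda>t. t \<in> (\<lambda>y. y - z k) ` P i) (ss k i)) \<and>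
         (\<exists>i. is_arg_min (\<lambda>i. \<Phi> (ss k i)) (\<lambda>i. i \<in> A) i \<and> s k = ss k i) \<and>
         (if \<Phi> (s k) = \<Phi> 0 then T = enat k
          else enat k < T \<and>
            (if \<Theta> (z k) - \<Theta> (z k + s k) \<ge> \<eta>1 * \<rho> k / 2 * (norm (s k))\<^sup>2
             then z (Suc k) = z k + s k \<and> \<rho> (Suc k) = \<rho> k
             else z (Suc k) = z k \<and> \<rho> (Suc k) = \<eta>2 * \<rho> k))))"

end

(* Let q = KFbar + sqrt J * Kcbar, and let y minimize Theta + (gamma/2) |. - z_k|^2. The model Phi_k
   agrees with Theta up to the prescribed multiples of |s|^2, and y lies in a polyhedron that is active
   at z_k because gamma is large. Comparing s_k with y - z_k in the subproblem and y with z_k + s_k in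
   the proximal problem gives
     (gamma - q - rho_k) |y - z_k|^2 <= (gamma + q - rho_k) |s_k|^2,
   hence |y - z_k|^2 <= 3 |s_k|^2 as soon as gamma >= rho_k + 2 q. By minimality of y, the directional
   derivatives of Theta at y are at least -gamma |y - z_k|, so a small step certifies approximate
   stationarity. Steps are rejected only while rho_k (1 - eta_1) < q, hence fewer than kappa_1 times,
   and each accepted long step decreases Theta by a fixed amount. *)
theory Submission
  imports Defs
begin

section \<open>Calculus of one-sided directional derivatives\<close>

section \<open>Directional derivatives\<close>

lemma has_dir_deriv_add:
  assumes "has_dir_deriv f x d D" "has_dir_deriv g x d E"
  shows "has_dir_deriv (\<lambda>x. f x + g x) x d (D + E)"
proof -
  have "(\<lambda>t. (f (x + t *\<^sub>R d) - f x) / t + (g (x + t *\<^sub>R d) - g x) / t)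
      = (\<lambda>t. (f (x + t *\<^sub>R d) + g (x + t *\<^sub>R d) - (f x + g x)) / t)"
    by (simp add: fun_eq_iff add_divide_distrib[symmetric] algebra_simps)
  then show ?thesis
    using tendsto_add[OF assms[unfolded has_dir_deriv_def]] unfolding has_dir_deriv_def by simp
qed

lemma has_dir_deriv_cmult:
  assumes "has_dir_deriv f x d D"
  shows "has_dir_deriv (\<lambda>x. c * f x) x d (c * D)"
proof -
  have "(\<lambda>t. c * ((f (x + t *\<^sub>R d) - f x) / t)) = (\<lambda>t. (c * f (x + t *\<^sub>R d) - c * f x) / t)"
    by (simp add: fun_eq_iff right_diff_distrib)
  then show ?thesis
    using tendsto_mult_left[OF assms[unfolded has_dir_deriv_def], of c]
    unfolding has_dir_deriv_def by simp
qed

lemma has_dir_deriv_const: "has_dir_deriv (\<lambda>_. c) x d 0"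
  by (simp add: has_dir_deriv_def)

lemma has_dir_deriv_sum:
  assumes "\<And>i. i \<in> S \<Longrightarrow> has_dir_deriv (f i) x d (D i)"
  shows "has_dir_deriv (\<lambda>x. \<Sum>i\<in>S. f i x) x d (\<Sum>i\<in>S. D i)"
  using assms
  by (induction S rule: infinite_finite_induct) (simp_all add: has_dir_deriv_const has_dir_deriv_add)

text \<open>Multiplying the difference quotient by \<open>t\<close> recovers the increment of
  \<open>f\<close>. This continuity along the ray is what keeps a nonzero sign of \<open>f\<close>
  constant for small \<open>t\<close> in \<open>has_dir_deriv_abs\<close>.\<close>

lemma has_dir_deriv_imp_tendsto:
  assumes "has_dir_deriv f x d D"
  shows "((\<lambda>t. f (x + t *\<^sub>R d)) \<longlongrightarrow> f x) (at_right 0)"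
proof -
  have "((\<lambda>t. f x + t * ((f (x + t *\<^sub>R d) - f x) / t)) \<longlongrightarrow> f x + 0 * D) (at_right 0)"
    using assms unfolding has_dir_deriv_def by (intro tendsto_intros)
  moreover have "\<forall>\<^sub>F t in at_right (0::real).
      f x + t * ((f (x + t *\<^sub>R d) - f x) / t) = f (x + t *\<^sub>R d)"
    using eventually_at_right_less[of 0] by eventually_elim simp
  ultimately have "((\<lambda>t. f (x + t *\<^sub>R d)) \<longlongrightarrow> f x + 0 * D) (at_right 0)"
    by (rule Lim_transform_eventually)
  then show ?thesis
    by simp
qed

text \<open>Where \<open>f x\<close> is nonzero, its sign persists along a short piece of the ray
  and the quotient is that of \<open>f\<close> or of its negative. At a zero, the quotient of the
  absolute value is the absolute value of the quotient because \<open>t > 0\<close>.\<close>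

lemma has_dir_deriv_abs:
  assumes "has_dir_deriv f x d D"
  shows "\<exists>E. has_dir_deriv (\<lambda>x. \<bar>f x\<bar>) x d E"
proof (cases "f x" "0::real" rule: linorder_cases)
  case equal
  have "((\<lambda>t. \<bar>(f (x + t *\<^sub>R d) - f x) / t\<bar>) \<longlongrightarrow> \<bar>D\<bar>) (at_right 0)"
    using assms unfolding has_dir_deriv_def by (intro tendsto_intros)
  moreover have "\<forall>\<^sub>F t in at_right (0::real).
      \<bar>(f (x + t *\<^sub>R d) - f x) / t\<bar> = (\<bar>f (x + t *\<^sub>R d)\<bar> - \<bar>f x\<bar>) / t"
    using eventually_at_right_less[of 0] by eventually_elim (simp add: equal)
  ultimately show ?thesis
    unfolding has_dir_deriv_def by (blast intro: Lim_transform_eventually)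
next
  case less
  have "\<forall>\<^sub>F t in at_right 0. f (x + t *\<^sub>R d) < 0"
    using order_tendstoD(2)[OF has_dir_deriv_imp_tendsto[OF assms] less] .
  then have "\<forall>\<^sub>F t in at_right 0.
      - ((f (x + t *\<^sub>R d) - f x) / t) = (\<bar>f (x + t *\<^sub>R d)\<bar> - \<bar>f x\<bar>) / t"
    by eventually_elim (use less in \<open>simp add: minus_divide_left\<close>)
  moreover have "((\<lambda>t. - ((f (x + t *\<^sub>R d) - f x) / t)) \<longlongrightarrow> - D) (at_right 0)"
    using assms unfolding has_dir_deriv_def by (intro tendsto_intros)
  ultimately show ?thesis
    unfolding has_dir_deriv_def by (blast intro: Lim_transform_eventually)
next
  case greater
  have "\<forall>\<^sub>F t in at_right 0. f (x + t *\<^sub>R d) > 0"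
    using order_tendstoD(1)[OF has_dir_deriv_imp_tendsto[OF assms] greater] .
  then have "\<forall>\<^sub>F t in at_right 0.
      (f (x + t *\<^sub>R d) - f x) / t = (\<bar>f (x + t *\<^sub>R d)\<bar> - \<bar>f x\<bar>) / t"
    by eventually_elim (use greater in simp)
  then show ?thesis
    using assms unfolding has_dir_deriv_def by (blast intro: Lim_transform_eventually)
qed

text \<open>The quotient is an affine function of \<open>t\<close>. A general linear
  \<open>f\<close> lets the rule serve both the regularizer in \<open>fst\<close> and the proximal
  term.\<close>

lemma has_dir_deriv_norm_sq:
  fixes f :: "'a::real_normed_vector \<Rightarrow> 'b::real_inner"
  assumes "linear f"
  shows "has_dir_deriv (\<lambda>x. (norm (f x))\<^sup>2) x d (2 * (f x \<bullet> f d))"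
proof -
  have "((\<lambda>t. 2 * (f x \<bullet> f d) + t * (f d \<bullet> f d)) \<longlongrightarrow> 2 * (f x \<bullet> f d)) (at_right 0)"
    by (auto intro!: tendsto_eq_intros)
  moreover have "\<forall>\<^sub>F t in at_right (0::real). 2 * (f x \<bullet> f d) + t * (f d \<bullet> f d)
      = ((norm (f (x + t *\<^sub>R d)))\<^sup>2 - (norm (f x))\<^sup>2) / t"
    using eventually_at_right_less[of 0]
    by eventually_elim
      (simp add: linear_add[OF assms] linear_scale[OF assms] power2_norm_eq_inner inner_add
        inner_commute field_simps)
  ultimately show ?thesis
    unfolding has_dir_deriv_def by (blast intro: Lim_transform_eventually)
qed

section \<open>Gradients and linearization errors along segments\<close>

section \<open>Gradients\<close>

lemma grad_eqI:
  assumes "GDERIV f x :> D"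
  shows "grad f x = D"
  unfolding grad_def
proof (rule the_equality)
  show "GDERIV f x :> D"
    by (fact assms)
next
  fix E assume "GDERIV f x :> E"
  then have "(\<lambda>h. h \<bullet> E) = (\<lambda>h. h \<bullet> D)"
    using assms unfolding gderiv_def by (rule has_derivative_unique)
  \<comment> \<open>Testing both derivatives in the direction \<open>E - D\<close> gives that the
    squared norm of \<open>E - D\<close> vanishes.\<close>
  then have "(E - D) \<bullet> E = (E - D) \<bullet> D"
    by meson
  then show "E = D"
    by (metis eq_iff_diff_eq_0 inner_diff_right inner_eq_zero_iff)
qed

lemma GDERIV_grad:
  assumes "\<exists>D. GDERIV f x :> D"
  shows "GDERIV f x :> grad f x"
  using assms grad_eqI by blast

lemma smooth_fun_GDERIV: "smooth_fun f \<Longrightarrow> GDERIV f x :> grad f x"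
  by (simp add: smooth_fun_def GDERIV_grad)

lemma GDERIV_line:
  assumes "GDERIV f (x + t *\<^sub>R v) :> D"
  shows "((\<lambda>t. f (x + t *\<^sub>R v)) has_real_derivative D \<bullet> v) (at t)"
proof -
  have "((\<lambda>t. x + t *\<^sub>R v) has_derivative (\<lambda>h. h *\<^sub>R v)) (at t)"
    by (auto intro!: derivative_eq_intros)
  then have "((\<lambda>t. f (x + t *\<^sub>R v)) has_derivative (\<lambda>h. (h *\<^sub>R v) \<bullet> D)) (at t)"
    using has_derivative_compose[of "\<lambda>t. x + t *\<^sub>R v" _ t UNIV f "\<lambda>h. h \<bullet> D"] assms
    unfolding gderiv_def by blast
  then show ?thesis
    unfolding has_field_derivative_def
    by (rule has_derivative_eq_rhs) (simp add: fun_eq_iff inner_commute)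
qed

text \<open>The gradient is compared only along the segment starting at \<open>x\<close>, and only
  with its value at \<open>x\<close>, since the Lipschitz constants are valid only near a level
  set.\<close>

lemma descent_upper:
  assumes "\<And>x. GDERIV f x :> G x"
    and "\<And>t. 0 \<le> t \<Longrightarrow> t \<le> 1 \<Longrightarrow> norm (G (x + t *\<^sub>R v) - G x) \<le> K * norm (t *\<^sub>R v)"
  shows "f (x + v) - f x - G x \<bullet> v \<le> K / 2 * (norm v)\<^sup>2"
proof -
  \<comment> \<open>\<open>h\<close> is \<open>f\<close> on the segment minus the linear term and
    the claimed quadratic bound. The Lipschitz estimate and Cauchy-Schwarz make its derivative
    nonpositive.\<close>
  define h where "h t = f (x + t *\<^sub>R v) - t * (G x \<bullet> v) - K / 2 * (norm v)\<^sup>2 * t\<^sup>2" for t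
  have "h 1 \<le> h 0"
  proof (rule DERIV_nonpos_imp_nonincreasing[of 0 1])
    fix t :: real assume t: "0 \<le> t" "t \<le> 1"
    have "(h has_real_derivative G (x + t *\<^sub>R v) \<bullet> v - G x \<bullet> v - K * (norm v)\<^sup>2 * t) (at t)"
      unfolding h_def by (rule derivative_eq_intros GDERIV_line assms(1) refl | simp)+
    moreover have "(G (x + t *\<^sub>R v) - G x) \<bullet> v \<le> norm (G (x + t *\<^sub>R v) - G x) * norm v"
      by (rule norm_cauchy_schwarz)
    moreover have "\<dots> \<le> K * norm (t *\<^sub>R v) * norm v"
      using assms(2)[OF t] by (rule mult_right_mono) simp
    moreover have "\<dots> = K * (norm v)\<^sup>2 * t"
      using t by (simp add: power2_eq_square)
    ultimately show "\<exists>y. (h has_real_derivative y) (at t) \<and> y \<le> 0"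
      unfolding inner_diff_left by (intro exI conjI) (assumption, linarith)
  qed simp
  then show ?thesis
    by (simp add: h_def)
qed

lemma descent_abs:
  assumes "\<And>x. GDERIV f x :> G x"
    and "\<And>t. 0 \<le> t \<Longrightarrow> t \<le> 1 \<Longrightarrow> norm (G (x + t *\<^sub>R v) - G x) \<le> K * norm (t *\<^sub>R v)"
  shows "\<bar>f (x + v) - f x - G x \<bullet> v\<bar> \<le> K / 2 * (norm v)\<^sup>2"
proof -
  have "- f (x + v) - (- f x) - (- G x) \<bullet> v \<le> K / 2 * (norm v)\<^sup>2"
  proof (rule descent_upper)
    show "GDERIV (\<lambda>x. - f x) x :> - G x" for x
      using assms(1) by (rule GDERIV_minus)
    show "norm (- G (x + t *\<^sub>R v) - - G x) \<le> K * norm (t *\<^sub>R v)" if "0 \<le> t" "t \<le> 1" for t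
      using assms(2)[OF that] by (simp add: norm_minus_commute)
  qed
  moreover have "f (x + v) - f x - G x \<bullet> v \<le> K / 2 * (norm v)\<^sup>2"
    using assms by (rule descent_upper)
  ultimately show ?thesis
    unfolding abs_le_iff by simp
qed

lemma GDERIV_sum:
  assumes "\<And>i. i \<in> S \<Longrightarrow> GDERIV (f i) x :> G i"
  shows "GDERIV (\<lambda>x. \<Sum>i\<in>S. f i x) x :> (\<Sum>i\<in>S. G i)"
  using assms unfolding gderiv_def inner_sum_right by (rule has_derivative_sum)

lemma GDERIV_cmult:
  assumes "GDERIV f x :> G"
  shows "GDERIV (\<lambda>x. c * f x) x :> c *\<^sub>R G"
  using assms unfolding gderiv_def inner_scaleR_right by (rule has_derivative_mult_right)

text \<open>Needed because \<open>onorm\<close> controls individual values only for bounded linear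
  maps.\<close>

lemma bounded_linear_jac_T: "bounded_linear (jac_T \<J> c x)" for \<J> :: "'m::finite set"
  unfolding jac_T_def[abs_def]
  by (rule bounded_linear_sum) (rule bounded_linear_scaleR_const[OF bounded_linear_vec_nth])

text \<open>The signs of the linearization errors turn the sum into the error of a single function
  with gradient \<^term>\<open>jac_T \<J> c x w\<close>, where \<open>\<parallel>w\<parallel> = sqrt (card \<J>)\<close>.\<close>

lemma descent_sum_abs:
  fixes \<J> :: "'m::finite set" and c :: "'m \<Rightarrow> 'a::real_inner \<Rightarrow> real"
  assumes diff: "\<And>j x. j \<in> \<J> \<Longrightarrow> \<exists>D. GDERIV (c j) x :> D"
    and lip: "\<And>t. 0 \<le> t \<Longrightarrow> t \<le> 1 \<Longrightarrow>
      onorm (\<lambda>w. jac_T \<J> c (x + t *\<^sub>R v) w - jac_T \<J> c x w) \<le> K * norm (t *\<^sub>R v)"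
  shows "(\<Sum>j\<in>\<J>. \<bar>c j (x + v) - c j x - grad (c j) x \<bullet> v\<bar>)
    \<le> sqrt (real (card \<J>)) * K / 2 * (norm v)\<^sup>2"
proof -
  define e where "e j = c j (x + v) - c j x - grad (c j) x \<bullet> v" for j
  define w :: "real^'m" where
    "w = (\<chi> j. if j \<in> \<J> then (if e j < 0 then -1 else 1) else 0)"
  have "(norm w)\<^sup>2 = (\<Sum>j\<in>UNIV. if j \<in> \<J> then 1 else 0)"
    unfolding power2_norm_eq_inner inner_vec_def by (intro sum.cong) (auto simp: w_def)
  also have "\<dots> = real (card \<J>)"
    by (simp add: sum.If_cases)
  finally have norm_w: "norm w = sqrt (real (card \<J>))"
    by (metis norm_ge_zero real_sqrt_unique)
  have "(\<Sum>j\<in>\<J>. w $ j * c j (x + v)) - (\<Sum>j\<in>\<J>. w $ j * c j x) - jac_T \<J> c x w \<bullet> v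
      \<le> (sqrt (real (card \<J>)) * K) / 2 * (norm v)\<^sup>2"
  proof (rule descent_upper)
    show "GDERIV (\<lambda>x. \<Sum>j\<in>\<J>. w $ j * c j x) x :> jac_T \<J> c x w" for x
      unfolding jac_T_def by (intro GDERIV_sum GDERIV_cmult GDERIV_grad diff)
    fix t :: real assume t: "0 \<le> t" "t \<le> 1"
    have "norm (jac_T \<J> c (x + t *\<^sub>R v) w - jac_T \<J> c x w)
        \<le> onorm (\<lambda>w. jac_T \<J> c (x + t *\<^sub>R v) w - jac_T \<J> c x w) * norm w"
      by (rule onorm) (intro bounded_linear_sub bounded_linear_jac_T)
    also have "\<dots> \<le> K * norm (t *\<^sub>R v) * norm w"
      using lip[OF t] by (rule mult_right_mono) simp
    finally show "norm (jac_T \<J> c (x + t *\<^sub>R v) w - jac_T \<J> c x w)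
        \<le> sqrt (real (card \<J>)) * K * norm (t *\<^sub>R v)"
      by (simp add: norm_w mult_ac)
  qed
  moreover have "(\<Sum>j\<in>\<J>. \<bar>e j\<bar>) = (\<Sum>j\<in>\<J>. w $ j * e j)"
    by (intro sum.cong) (auto simp: w_def)
  ultimately show ?thesis
    by (simp add: e_def jac_T_def right_diff_distrib sum_subtractf inner_sum_left)
qed

section \<open>Existence of proximal points and their first-order condition\<close>

section \<open>Proximal points\<close>

text \<open>A minimizer over the compact sublevel set \<open>S\<close> of \<open>x\<close> is
  global: outside \<open>S\<close> the function already exceeds \<open>f x\<close>, which is the
  proximal objective at \<open>x\<close>.\<close>

lemma ex_proximal_point:
  fixes f :: "'a::euclidean_space \<Rightarrow> real"
  assumes cont: "continuous_on UNIV f" and bdd: "\<And>a. bounded {x. f x \<le> a}" and "\<gamma> \<ge> 0"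
  shows "\<exists>y. \<forall>w. f y + \<gamma> / 2 * (norm (y - x))\<^sup>2 \<le> f w + \<gamma> / 2 * (norm (w - x))\<^sup>2"
proof -
  define S where "S = {w. f w \<le> f x}"
  have "closed S"
    unfolding S_def using cont by (intro closed_Collect_le) auto
  then have "compact S"
    using bdd by (simp add: S_def compact_eq_bounded_closed)
  moreover have "x \<in> S"
    by (simp add: S_def)
  moreover have "continuous_on S (\<lambda>w. f w + \<gamma> / 2 * (norm (w - x))\<^sup>2)"
    using continuous_on_subset[OF cont] by (intro continuous_intros) auto
  ultimately obtain y where y: "y \<in> S"
    "\<And>w. w \<in> S \<Longrightarrow> f y + \<gamma> / 2 * (norm (y - x))\<^sup>2 \<le> f w + \<gamma> / 2 * (norm (w - x))\<^sup>2"
    using continuous_attains_inf[of S] by fast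
  have "f y + \<gamma> / 2 * (norm (y - x))\<^sup>2 \<le> f w + \<gamma> / 2 * (norm (w - x))\<^sup>2" for w
  proof (cases "w \<in> S")
    case False
    have "f y + \<gamma> / 2 * (norm (y - x))\<^sup>2 \<le> f x"
      using y(2)[OF \<open>x \<in> S\<close>] by simp
    also have "\<dots> \<le> f w + \<gamma> / 2 * (norm (w - x))\<^sup>2"
      using False \<open>\<gamma> \<ge> 0\<close> by (simp add: S_def add_increasing2)
    finally show ?thesis .
  qed (fact y(2))
  then show ?thesis
    by blast
qed

text \<open>At the minimizer \<open>y\<close> the proximal objective has a nonnegative one-sided
  derivative. The quadratic term contributes \<open>\<gamma> * ((y - x) \<bullet> d)\<close> to it,
  which Cauchy-Schwarz bounds.\<close>

lemma proximal_point_dir_deriv_ge: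
  fixes f :: "'a::real_inner \<Rightarrow> real"
  assumes min: "\<And>w. f y + \<gamma> / 2 * (norm (y - x))\<^sup>2 \<le> f w + \<gamma> / 2 * (norm (w - x))\<^sup>2"
    and "\<gamma> \<ge> 0" and D: "has_dir_deriv f y d D"
  shows "D \<ge> - (\<gamma> * norm (y - x) * norm d)"
proof -
  have "has_dir_deriv (\<lambda>w. \<gamma> / 2 * (norm (w - x))\<^sup>2) y d (\<gamma> / 2 * (2 * ((y - x) \<bullet> d)))"
    using has_dir_deriv_norm_sq[of "\<lambda>w. w" "y - x" d]
    by (intro has_dir_deriv_cmult) (simp add: has_dir_deriv_def algebra_simps linear_iff)
  from has_dir_deriv_add[OF D this]
  have "((\<lambda>t. (f (y + t *\<^sub>R d) + \<gamma> / 2 * (norm (y + t *\<^sub>R d - x))\<^sup>2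
      - (f y + \<gamma> / 2 * (norm (y - x))\<^sup>2)) / t) \<longlongrightarrow> D + \<gamma> * ((y - x) \<bullet> d)) (at_right 0)"
    unfolding has_dir_deriv_def by simp
  then have "0 \<le> D + \<gamma> * ((y - x) \<bullet> d)"
  proof (rule tendsto_lowerbound)
    show "\<forall>\<^sub>F t in at_right 0. 0 \<le> (f (y + t *\<^sub>R d) + \<gamma> / 2 * (norm (y + t *\<^sub>R d - x))\<^sup>2
      - (f y + \<gamma> / 2 * (norm (y - x))\<^sup>2)) / t"
      using eventually_at_right_less[of 0] by eventually_elim (use min in \<open>auto intro!: divide_nonneg_pos\<close>)
  qed simp
  moreover have "\<gamma> * ((y - x) \<bullet> d) \<le> \<gamma> * (norm (y - x) * norm d)"
    using \<open>\<gamma> \<ge> 0\<close> by (intro mult_left_mono norm_cauchy_schwarz)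
  ultimately show ?thesis
    by (simp add: mult.assoc)
qed

section \<open>Complexity analysis of a run in a Euclidean space\<close>

section \<open>Runs of the algorithm\<close>

text \<open>Separates the complexity argument from the layered form of the problem. The Lipschitz
  bounds are centred at a point of the initial level set; the radius \<open>R\<close> is large
  enough for all displacements that occur, both model steps and proximal points.\<close>

locale srpa =
  fixes \<Theta> F H :: "'a::euclidean_space \<Rightarrow> real"
    and \<J> :: "'m::finite set" and c :: "'m \<Rightarrow> 'a \<Rightarrow> real"
    and I :: nat and P :: "nat \<Rightarrow> 'a set"
    and \<eta>1 \<eta>2 \<delta> :: real
    and z s :: "nat \<Rightarrow> 'a" and \<rho> :: "nat \<Rightarrow> real" and ss :: "nat \<Rightarrow> nat \<Rightarrow> 'a" and T :: enat
    and KF KFbar Kcbar \<Theta>star R q :: real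
  assumes \<Theta>_eq: "\<And>x. \<Theta> x = F x + H x + (\<Sum>j\<in>\<J>. \<bar>c j x\<bar>)"
    and F_nonneg: "\<And>x. F x \<ge> 0" and H_nonneg: "\<And>x. H x \<ge> 0"
    and F_diff: "\<And>x. \<exists>D. GDERIV F x :> D"
    and c_diff: "\<And>j x. j \<in> \<J> \<Longrightarrow> \<exists>D. GDERIV (c j) x :> D"
    and \<Theta>_cont: "continuous_on UNIV \<Theta>"
    and \<Theta>_dir: "\<And>x d. \<exists>D. has_dir_deriv \<Theta> x d D"
    and \<Theta>_bounded: "\<And>a. bounded {x. \<Theta> x \<le> a}"
    and \<Theta>star_le: "\<And>x. \<Theta>star \<le> \<Theta> x"
    and cover: "(\<Union>i\<in>{1..I}. P i) = UNIV"
    and \<rho>1: "\<rho> 1 > 0" and \<eta>1: "0 < \<eta>1" "\<eta>1 < 1" and \<eta>2: "\<eta>2 > 1" and \<delta>: "\<delta> > 0"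
    and run: "srpa_run \<Theta> F H \<J> c I P \<eta>1 \<eta>2 \<delta> z \<rho> ss s T"
    and KF_pos: "KF > 0" and KF: "\<And>x. \<Theta> x \<le> \<Theta> (z 1) \<Longrightarrow> norm (grad F x) \<le> KF"
    and K_pos: "KFbar > 0" "Kcbar > 0"
    and R: "R = 2 * KF / \<rho> 1 + sqrt (2 * \<Theta> (z 1) / \<rho> 1)"
    and q: "q = KFbar + sqrt (real (card \<J>)) * Kcbar"
    and F_lip: "\<And>x v. \<Theta> x \<le> \<Theta> (z 1) \<Longrightarrow> norm v \<le> R \<Longrightarrow>
      norm (grad F (x + v) - grad F x) \<le> KFbar * norm v"
    and c_lip: "\<And>x v. \<Theta> x \<le> \<Theta> (z 1) \<Longrightarrow> norm v \<le> R \<Longrightarrow>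
      onorm (\<lambda>w. jac_T \<J> c (x + v) w - jac_T \<J> c x w) \<le> Kcbar * norm v"
begin

abbreviation \<Phi> :: "'a \<Rightarrow> real \<Rightarrow> 'a \<Rightarrow> real" where
  "\<Phi> \<equiv> model_Phi F H \<J> c"

lemma q_pos: "q > 0"
  using K_pos by (simp add: q add_pos_nonneg)

lemma \<Theta>_nonneg: "\<Theta> x \<ge> 0"
  unfolding \<Theta>_eq by (intro add_nonneg_nonneg F_nonneg H_nonneg sum_nonneg abs_ge_zero)

lemma R_pos: "R > 0"
  using KF_pos \<rho>1 \<Theta>_nonneg[of "z 1"] by (simp add: R add_pos_nonneg)

lemma \<Phi>_0: "\<Phi> x r 0 = \<Theta> x"
  by (simp add: model_Phi_def \<Theta>_eq)

text \<open>The model keeps \<open>H\<close> exact, so only the linearizations of \<open>F\<close>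
  and of the \<open>c j\<close> produce errors. The absolute value is 1-Lipschitz, hence the errors
  of the \<open>c j\<close> pass through it, and the two constants add up to
  \<open>q\<close>.\<close>

lemma model_error:
  assumes x: "\<Theta> x \<le> \<Theta> (z 1)" and v: "norm v \<le> R"
  shows "\<bar>\<Theta> (x + v) - (\<Phi> x r v - r / 2 * (norm v)\<^sup>2)\<bar> \<le> q / 2 * (norm v)\<^sup>2"
proof -
  have seg: "norm (t *\<^sub>R v) \<le> R" if "0 \<le> t" "t \<le> 1" for t
    using v mult_left_le_one_le[of "norm v" t] that by simp
  define eF where "eF = F (x + v) - F x - grad F x \<bullet> v"
  define e where "e j = \<bar>c j (x + v)\<bar> - \<bar>c j x + grad (c j) x \<bullet> v\<bar>" for j
  have "\<bar>eF\<bar> \<le> KFbar / 2 * (norm v)\<^sup>2"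
    unfolding eF_def by (intro descent_abs GDERIV_grad F_diff F_lip x seg)
  moreover have "\<bar>\<Sum>j\<in>\<J>. e j\<bar> \<le> sqrt (real (card \<J>)) * Kcbar / 2 * (norm v)\<^sup>2"
  proof -
    have "\<bar>\<Sum>j\<in>\<J>. e j\<bar> \<le> (\<Sum>j\<in>\<J>. \<bar>e j\<bar>)"
      by (rule sum_abs)
    also have "\<dots> \<le> (\<Sum>j\<in>\<J>. \<bar>c j (x + v) - c j x - grad (c j) x \<bullet> v\<bar>)"
      unfolding e_def by (intro sum_mono) linarith
    also have "\<dots> \<le> sqrt (real (card \<J>)) * Kcbar / 2 * (norm v)\<^sup>2"
      by (intro descent_sum_abs c_diff c_lip x seg)
    finally show ?thesis .
  qed
  moreover have "\<Theta> (x + v) - (\<Phi> x r v - r / 2 * (norm v)\<^sup>2) = eF + (\<Sum>j\<in>\<J>. e j)"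
    by (simp add: \<Theta>_eq model_Phi_def eF_def e_def sum_subtractf)
  ultimately show ?thesis
    unfolding q by (simp add: algebra_simps add_divide_distrib)
qed

text \<open>Since \<open>F\<close>, \<open>H\<close> and the absolute values are nonnegative, a step
  that does not raise the model above its value at 0 satisfies a quadratic inequality in
  \<open>norm v\<close>. The sum \<open>a + b\<close> bounds its solutions.\<close>

lemma step_le_R:
  assumes x: "\<Theta> x \<le> \<Theta> (z 1)" and r: "\<rho> 1 \<le> r" and v: "\<Phi> x r v \<le> \<Theta> x"
  shows "norm v \<le> R"
proof (rule ccontr)
  define a where "a = 2 * KF / \<rho> 1"
  define b where "b = sqrt (2 * \<Theta> (z 1) / \<rho> 1)"
  assume "\<not> norm v \<le> R"
  then have gt: "norm v > a + b"
    by (simp add: R a_def b_def)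
  have ab: "a > 0" "b \<ge> 0" "b\<^sup>2 = 2 * \<Theta> (z 1) / \<rho> 1"
    using KF_pos \<rho>1 \<Theta>_nonneg[of "z 1"] by (simp_all add: a_def b_def)
  have "\<bar>grad F x \<bullet> v\<bar> \<le> norm (grad F x) * norm v"
    by (rule Cauchy_Schwarz_ineq2)
  also have "\<dots> \<le> KF * norm v"
    using KF[OF x] by (rule mult_right_mono) simp
  finally have "r / 2 * (norm v)\<^sup>2 - KF * norm v \<le> \<Phi> x r v"
    using F_nonneg[of x] H_nonneg[of "x + v"]
      sum_nonneg[of \<J> "\<lambda>j. \<bar>c j x + grad (c j) x \<bullet> v\<bar>"]
    unfolding model_Phi_def by linarith
  moreover have "\<rho> 1 / 2 * (norm v)\<^sup>2 \<le> r / 2 * (norm v)\<^sup>2"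
    using r by (intro mult_right_mono) auto
  ultimately have "\<rho> 1 / 2 * (norm v)\<^sup>2 \<le> KF * norm v + \<Theta> (z 1)"
    using v x by linarith
  then have "(norm v)\<^sup>2 \<le> a * norm v + b\<^sup>2"
    using \<rho>1 by (simp add: ab(3) a_def field_simps)
  \<comment> \<open>The assumed \<open>norm v > a + b\<close> gives \<open>b \<le> norm v\<close>,
    which absorbs one factor of \<open>b\<^sup>2\<close>.\<close>
  also have "\<dots> \<le> a * norm v + b * norm v"
    using ab(1,2) gt by (auto simp: power2_eq_square intro!: mult_left_mono)
  also have "\<dots> < norm v * norm v"
    unfolding distrib_right[symmetric] using gt ab by (intro mult_strict_right_mono) auto
  finally show False
    by (simp add: power2_eq_square)
qed

text \<open>Stated for any \<open>v\<close> that competes well enough in the subproblems, not only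
  for the computed step, so that it also applies to \<open>v = 0\<close> when the algorithm
  terminates.\<close>

lemma stationary_if_small_step:
  assumes x: "\<Theta> x \<le> \<Theta> (z 1)" and r: "\<rho> 1 \<le> r" "r + 2 * q \<le> \<gamma>"
    and \<gamma>: "2 * (\<Theta> (z 1) - \<Theta>star) \<le> \<gamma> * R\<^sup>2" "8 * (\<Theta> (z 1) - \<Theta>star) \<le> \<gamma> * \<delta>\<^sup>2" "1 \<le> \<gamma>"
    and v: "\<Phi> x r v \<le> \<Theta> x"
    and v_min: "\<And>i w. i \<in> active I P \<delta> x \<Longrightarrow> w \<in> P i \<Longrightarrow> \<Phi> x r v \<le> \<Phi> x r (w - x)"
    and small: "3 * \<gamma>\<^sup>2 * (norm v)\<^sup>2 \<le> \<epsilon>\<^sup>2" and \<epsilon>: "\<epsilon> > 0"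
  shows "approx_d_stationary \<Theta> \<epsilon> x"
proof -
  obtain y where y: "\<And>w. \<Theta> y + \<gamma> / 2 * (norm (y - x))\<^sup>2 \<le> \<Theta> w + \<gamma> / 2 * (norm (w - x))\<^sup>2"
    using ex_proximal_point[OF \<Theta>_cont \<Theta>_bounded, of \<gamma> x] \<gamma>(3) by auto
  \<comment> \<open>Comparing \<open>y\<close> with \<open>x\<close> in the proximal problem. The
    two lower bounds on \<gamma> in terms of \<open>R\<close> and \<delta> then place
    \<open>y\<close> within both radii of \<open>x\<close>.\<close>
  have near: "\<gamma> * (norm (y - x))\<^sup>2 \<le> 2 * (\<Theta> (z 1) - \<Theta>star)"
    using y[of x] \<Theta>star_le[of y] x by simp
  have y_R: "norm (y - x) \<le> R"
  proof -
    have "\<gamma> * (norm (y - x))\<^sup>2 \<le> \<gamma> * R\<^sup>2"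
      using near \<gamma>(1) by linarith
    then have "(norm (y - x))\<^sup>2 \<le> R\<^sup>2"
      by (rule mult_left_le_imp_le) (use \<gamma>(3) in linarith)
    then show ?thesis
      using R_pos by (simp add: abs_le_square_iff[symmetric])
  qed
  have y_\<delta>: "norm (y - x) \<le> \<delta>"
  proof -
    have "2 * (\<Theta> (z 1) - \<Theta>star) \<le> 8 * (\<Theta> (z 1) - \<Theta>star)"
      using \<Theta>star_le[of "z 1"] by simp
    then have "\<gamma> * (norm (y - x))\<^sup>2 \<le> \<gamma> * \<delta>\<^sup>2"
      using near \<gamma>(2) by (meson order_trans)
    then have "(norm (y - x))\<^sup>2 \<le> \<delta>\<^sup>2"
      by (rule mult_left_le_imp_le) (use \<gamma>(3) in linarith)
    then show ?thesis
      using \<delta> by (simp add: abs_le_square_iff[symmetric])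
  qed
  obtain i where i: "i \<in> {1..I}" "y \<in> P i"
    using cover by blast
  \<comment> \<open>The distance from \<open>x\<close> to a polyhedron containing \<open>y\<close>
    is at most \<open>norm (y - x)\<close>, hence at most \<delta>, so \<open>y - x\<close> is a
    competitor of \<open>v\<close>.\<close>
  then have "i \<in> active I P \<delta> x"
    using infdist_le[of y "P i" x] y_\<delta> by (simp add: active_def dist_norm norm_minus_commute)
  then have "\<Phi> x r v \<le> \<Phi> x r (y - x)"
    using v_min i by blast
  moreover have "\<Phi> x r (y - x) \<le> \<Theta> y + (q + r) / 2 * (norm (y - x))\<^sup>2"
    using model_error[OF x y_R, of r] unfolding distrib_right add_divide_distrib abs_le_iff by simp
  moreover have "\<Theta> (x + v) \<le> \<Phi> x r v + (q - r) / 2 * (norm v)\<^sup>2"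
    using model_error[OF x step_le_R[OF x r(1) v], of r]
    unfolding left_diff_distrib diff_divide_distrib abs_le_iff by simp
  moreover have "\<Theta> y + \<gamma> / 2 * (norm (y - x))\<^sup>2 \<le> \<Theta> (x + v) + \<gamma> / 2 * (norm v)\<^sup>2"
    using y[of "x + v"] by simp
  \<comment> \<open>In the sum of the four inequalities all values of \<open>\<Theta>\<close> and
    \<open>\<Phi>\<close> cancel.\<close>
  ultimately have "(\<gamma> - q - r) * (norm (y - x))\<^sup>2 \<le> (\<gamma> + q - r) * (norm v)\<^sup>2"
    by (simp add: algebra_simps add_divide_distrib diff_divide_distrib)
  \<comment> \<open>The factor 3 is exactly the condition \<open>r + 2 * q \<le> \<gamma>\<close>,
    which also gives \<open>\<gamma> - q - r \<ge> q > 0\<close> for the cancellation below.\<close>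
  also have "\<dots> \<le> (3 * (\<gamma> - q - r)) * (norm v)\<^sup>2"
    using r by (intro mult_right_mono) auto
  finally have "(\<gamma> - q - r) * (norm (y - x))\<^sup>2 \<le> (\<gamma> - q - r) * (3 * (norm v)\<^sup>2)"
    by (simp add: algebra_simps)
  then have "(norm (y - x))\<^sup>2 \<le> 3 * (norm v)\<^sup>2"
    by (rule mult_left_le_imp_le) (use r \<rho>1 q_pos in linarith)
  then have "\<gamma>\<^sup>2 * (norm (y - x))\<^sup>2 \<le> \<gamma>\<^sup>2 * (3 * (norm v)\<^sup>2)"
    by (intro mult_left_mono) auto
  then have "(\<gamma> * norm (y - x))\<^sup>2 \<le> \<epsilon>\<^sup>2"
    using small by (simp add: power_mult_distrib mult_ac)
  then have prox: "\<gamma> * norm (y - x) \<le> \<epsilon>"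
    by (rule power2_le_imp_le) (use \<epsilon> in simp)
  \<comment> \<open>Because \<open>1 \<le> \<gamma>\<close>, the bound \<open>prox\<close> on the
    slope also bounds the distance.\<close>
  have "y \<in> cball x \<epsilon>"
    using prox \<gamma>(3) mult_right_mono[of 1 \<gamma> "norm (y - x)"]
    by (simp add: dist_norm norm_minus_commute)
  moreover have "\<exists>D. has_dir_deriv \<Theta> y d D \<and> D \<ge> - \<epsilon>" if "norm d = 1" for d
  proof -
    obtain D where D: "has_dir_deriv \<Theta> y d D"
      using \<Theta>_dir by blast
    have "D \<ge> - (\<gamma> * norm (y - x) * norm d)"
      using y \<gamma>(3) D by (intro proximal_point_dir_deriv_ge[of \<Theta>]) auto
    then show ?thesis
      using D prox that by auto
  qed
  ultimately show ?thesis
    unfolding approx_d_stationary_def by blast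
qed

section \<open>A single iteration of the algorithm\<close>

context
  fixes k :: nat
  assumes k: "1 \<le> k" "enat k \<le> T"
begin

text \<open>Combines the two levels of minimization: each \<open>ss k i\<close> is best over its
  polyhedron, and \<open>s k\<close> is best among them.\<close>

lemma run_minimal:
  assumes "i \<in> active I P \<delta> (z k)" "w \<in> P i"
  shows "\<Phi> (z k) (\<rho> k) (s k) \<le> \<Phi> (z k) (\<rho> k) (w - z k)"
proof -
  let ?\<Phi> = "\<Phi> (z k) (\<rho> k)"
  obtain i' where "is_arg_min (\<lambda>i. ?\<Phi> (ss k i)) (\<lambda>i. i \<in> active I P \<delta> (z k)) i'" "s k = ss k i'"
    using run k unfolding srpa_run_def Let_def by blast
  then have "?\<Phi> (s k) \<le> ?\<Phi> (ss k i)"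
    using assms(1) by (auto simp: is_arg_min_def not_less)
  moreover have "is_arg_min ?\<Phi> (\<lambda>t. t \<in> (\<lambda>y. y - z k) ` P i) (ss k i)"
    using run k assms(1) unfolding srpa_run_def Let_def by blast
  then have "?\<Phi> (ss k i) \<le> ?\<Phi> (w - z k)"
    using assms(2) by (auto simp: is_arg_min_def not_less)
  ultimately show ?thesis
    by simp
qed

text \<open>A polyhedron containing \<open>z k\<close> is active, so the zero step is a
  competitor.\<close>

lemma run_step_le: "\<Phi> (z k) (\<rho> k) (s k) \<le> \<Theta> (z k)"
proof -
  obtain i where "i \<in> {1..I}" "z k \<in> P i"
    using cover by blast
  then show ?thesis
    using run_minimal[of i "z k"] \<delta> by (simp add: active_def \<Phi>_0)
qed

lemma run_continue:
  assumes "\<Phi> (z k) (\<rho> k) (s k) \<noteq> \<Theta> (z k)"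
  shows "enat k < T"
    and "\<eta>1 * \<rho> k / 2 * (norm (s k))\<^sup>2 \<le> \<Theta> (z k) - \<Theta> (z k + s k) \<Longrightarrow>
      z (Suc k) = z k + s k \<and> \<rho> (Suc k) = \<rho> k"
    and "\<not> \<eta>1 * \<rho> k / 2 * (norm (s k))\<^sup>2 \<le> \<Theta> (z k) - \<Theta> (z k + s k) \<Longrightarrow>
      z (Suc k) = z k \<and> \<rho> (Suc k) = \<eta>2 * \<rho> k"
  using run k assms unfolding srpa_run_def Let_def by (metis \<Phi>_0)+

text \<open>The model error leaves an actual decrease of at least
  \<open>(\<rho> k - q) / 2 * (norm (s k))\<^sup>2\<close>. This passes the acceptance test as soon
  as \<open>\<rho> k - q \<ge> \<eta>1 * \<rho> k\<close>.\<close>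

lemma rejected_imp_rho_less:
  assumes "\<Theta> (z k) \<le> \<Theta> (z 1)" "\<rho> 1 \<le> \<rho> k"
    and rej: "\<not> \<eta>1 * \<rho> k / 2 * (norm (s k))\<^sup>2 \<le> \<Theta> (z k) - \<Theta> (z k + s k)"
  shows "\<rho> k * (1 - \<eta>1) < q"
proof (rule ccontr)
  assume "\<not> \<rho> k * (1 - \<eta>1) < q"
  then have "\<eta>1 * \<rho> k / 2 * (norm (s k))\<^sup>2 \<le> (\<rho> k - q) / 2 * (norm (s k))\<^sup>2"
    by (intro mult_right_mono) (auto simp: algebra_simps)
  moreover have "(\<rho> k - q) / 2 * (norm (s k))\<^sup>2 \<le> \<Theta> (z k) - \<Theta> (z k + s k)"
    using model_error[OF assms(1) step_le_R[OF assms(1,2) run_step_le], of "\<rho> k"] run_step_le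
    unfolding left_diff_distrib diff_divide_distrib abs_le_iff by linarith
  ultimately show False
    using rej by linarith
qed

end

section \<open>Counting accepted and rejected steps\<close>

text \<open>Here \<open>m\<close> counts the rejected and \<open>n\<close> the accepted steps before iteration \<open>k\<close>, and \<open>a\<close> is a
  lower bound for the decrease of \<open>\<Theta>\<close> in an accepted step.\<close>

definition progress :: "real \<Rightarrow> nat \<Rightarrow> nat \<Rightarrow> nat \<Rightarrow> bool" where
  "progress a k m n \<longleftrightarrow> k = Suc (m + n) \<and> enat k \<le> T \<and> \<rho> k = \<rho> 1 * \<eta>2 ^ m \<and>
     \<Theta> (z k) + n * a \<le> \<Theta> (z 1) \<and> (m \<noteq> 0 \<longrightarrow> \<rho> k * (1 - \<eta>1) < \<eta>2 * q)"

lemma progress_1: "progress a 1 0 0"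
  using run by (simp add: progress_def srpa_run_def one_enat_def)

lemma progress_rho_ge: "progress a k m n \<Longrightarrow> \<rho> 1 \<le> \<rho> k"
  unfolding progress_def using \<rho>1 \<eta>2 by (metis le_less mult_le_cancel_left1 not_less one_le_power)

text \<open>An accepted step raises \<open>n\<close> and keeps \<rho>; it gains at least
  \<open>a\<close> because \<open>\<rho> k \<ge> \<rho> 1\<close>. A rejected step raises
  \<open>m\<close>, and the bound of \<open>rejected_imp_rho_less\<close> times
  \<open>\<eta>2\<close> is the last conjunct of \<open>progress\<close> for the enlarged
  \<rho>.\<close>

lemma progress_Suc:
  assumes "progress a k m n" and a: "0 \<le> a" "a \<le> \<eta>1 * \<rho> 1 / 2 * (norm (s k))\<^sup>2"
    and nt: "\<Phi> (z k) (\<rho> k) (s k) \<noteq> \<Theta> (z k)"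
  shows "\<exists>m n. progress a (Suc k) m n"
proof -
  have k: "1 \<le> k" "enat k \<le> T" and k_eq: "k = Suc (m + n)" and \<rho>_eq: "\<rho> k = \<rho> 1 * \<eta>2 ^ m"
    and dec: "\<Theta> (z k) + n * a \<le> \<Theta> (z 1)"
    and bound: "m \<noteq> 0 \<longrightarrow> \<rho> k * (1 - \<eta>1) < \<eta>2 * q"
    using assms(1) by (auto simp: progress_def)
  have ge: "\<rho> 1 \<le> \<rho> k"
    using assms(1) by (rule progress_rho_ge)
  have "0 \<le> n * a"
    using a by simp
  then have lev: "\<Theta> (z k) \<le> \<Theta> (z 1)"
    using dec by linarith
  have T: "enat (Suc k) \<le> T"
    using run_continue(1)[OF k nt] by (simp add: Suc_ile_eq)
  show ?thesis
  proof (cases "\<eta>1 * \<rho> k / 2 * (norm (s k))\<^sup>2 \<le> \<Theta> (z k) - \<Theta> (z k + s k)")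
    case True
    note next_iterate = run_continue(2)[OF k nt True]
    have "\<eta>1 * \<rho> 1 / 2 * (norm (s k))\<^sup>2 \<le> \<eta>1 * \<rho> k / 2 * (norm (s k))\<^sup>2"
      using ge \<eta>1 by (intro mult_right_mono) auto
    then have "\<Theta> (z k + s k) + Suc n * a \<le> \<Theta> (z 1)"
      using True a dec by (simp add: algebra_simps)
    then have "progress a (Suc k) m (Suc n)"
      using next_iterate T k_eq \<rho>_eq bound by (simp add: progress_def)
    then show ?thesis by blast
  next
    case False
    note next_iterate = run_continue(3)[OF k nt False]
    have "\<rho> k * (1 - \<eta>1) < q"
      using k lev ge False by (rule rejected_imp_rho_less)
    then have "\<eta>2 * (\<rho> k * (1 - \<eta>1)) < \<eta>2 * q"
      using \<eta>2 by (intro mult_strict_left_mono) auto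
    then have "progress a (Suc k) (Suc m) n"
      using next_iterate T k_eq \<rho>_eq dec by (simp add: progress_def mult_ac)
    then show ?thesis by blast
  qed
qed

text \<open>Supplies the condition on \<gamma> in \<open>stationary_if_small_step\<close>. One entry
  of the maximum handles \<rho> before any rejection, the other handles it after at least
  one.\<close>

lemma progress_rho_le:
  assumes "progress a k m n"
    and "\<rho> 1 * \<eta>2 + 2 * q \<le> \<gamma>" "(\<eta>2\<^sup>2 / (1 - \<eta>1) + 2) * q \<le> \<gamma>"
  shows "\<rho> k + 2 * q \<le> \<gamma>"
proof (cases "m = 0")
  case True
  then have "\<rho> k \<le> \<rho> 1 * \<eta>2"
    using assms(1) \<rho>1 \<eta>2 unfolding progress_def
    by (metis mult_le_cancel_left1 less_imp_le not_less mult.right_neutral power_0)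
  then show ?thesis
    using assms(2) by simp
next
  case False
  then have "\<rho> k * (1 - \<eta>1) < \<eta>2 * q"
    using assms(1) unfolding progress_def by blast
  also have "\<dots> \<le> \<eta>2\<^sup>2 * q"
    using \<eta>2 q_pos by (simp add: power2_eq_square)
  finally have "\<rho> k \<le> \<eta>2\<^sup>2 / (1 - \<eta>1) * q"
    using \<eta>1 by (simp add: field_simps)
  then show ?thesis
    using assms(3) by (simp add: algebra_simps)
qed

lemma progress_rejected_le:
  assumes "progress a k m n"
  shows "int m \<le> max 0 \<lceil>log \<eta>2 (q / (\<rho> 1 * (1 - \<eta>1)))\<rceil>"
\<comment> \<open>For \<open>m = Suc m'\<close> the last rejection took place at penalty
  \<open>\<rho> 1 * \<eta>2 ^ m'\<close>. Taking logarithms gives a strict bound for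
  \<open>m'\<close>, hence a non-strict one for \<open>m\<close> after rounding up.\<close>
proof (cases m)
  case (Suc m')
  then have "\<eta>2 * (\<rho> 1 * \<eta>2 ^ m' * (1 - \<eta>1)) < \<eta>2 * q"
    using assms unfolding progress_def by (metis mult.assoc mult.left_commute power_Suc nat.distinct(1))
  then have "\<rho> 1 * \<eta>2 ^ m' * (1 - \<eta>1) < q"
    by (rule mult_left_less_imp_less) (use \<eta>2 in simp)
  then have "\<eta>2 ^ m' < q / (\<rho> 1 * (1 - \<eta>1))"
    using \<rho>1 \<eta>1 by (simp add: pos_less_divide_eq mult_ac)
  then have "real m' < log \<eta>2 (q / (\<rho> 1 * (1 - \<eta>1)))"
    using \<eta>2 \<rho>1 \<eta>1 q_pos by (simp add: less_log_iff powr_realpow)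
  then have "int m' < \<lceil>log \<eta>2 (q / (\<rho> 1 * (1 - \<eta>1)))\<rceil>"
    by (simp add: less_ceiling_iff)
  then show ?thesis
    using Suc by simp
qed simp

theorem complexity:
  fixes \<epsilon> \<gamma> \<kappa> :: real
  assumes \<gamma>: "2 * (\<Theta> (z 1) - \<Theta>star) \<le> \<gamma> * R\<^sup>2" "8 * (\<Theta> (z 1) - \<Theta>star) \<le> \<gamma> * \<delta>\<^sup>2" "1 \<le> \<gamma>"
      "\<rho> 1 * \<eta>2 + 2 * q \<le> \<gamma>" "(\<eta>2\<^sup>2 / (1 - \<eta>1) + 2) * q \<le> \<gamma>"
    and \<epsilon>: "\<epsilon> > 0"
    and \<kappa>: "\<kappa> = max 0 (real_of_int \<lceil>log \<eta>2 (q / (\<rho> 1 * (1 - \<eta>1)))\<rceil>) + 1"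
  shows "\<exists>k\<ge>1. enat k \<le> T \<and>
    int k \<le> \<lceil>\<kappa> + 6 * \<gamma>\<^sup>2 / (\<eta>1 * \<rho> 1) * (\<Theta> (z 1) - \<Theta>star) / \<epsilon>\<^sup>2\<rceil> \<and>
    approx_d_stationary \<Theta> \<epsilon> (z k)"
proof (rule ccontr)
  define M where "M = \<lceil>\<kappa> + 6 * \<gamma>\<^sup>2 / (\<eta>1 * \<rho> 1) * (\<Theta> (z 1) - \<Theta>star) / \<epsilon>\<^sup>2\<rceil>"
  \<comment> \<open>The guaranteed decrease \<open>\<eta>1 * \<rho> 1 / 2 * (norm v)\<^sup>2\<close>
    at the threshold \<open>(norm v)\<^sup>2 = \<epsilon>\<^sup>2 / (3 * \<gamma>\<^sup>2)\<close>
    of \<open>stationary_if_small_step\<close>.\<close>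
  define a where "a = \<eta>1 * \<rho> 1 * \<epsilon>\<^sup>2 / (6 * \<gamma>\<^sup>2)"
  assume "\<not> ?thesis"
  then have none: "\<not> approx_d_stationary \<Theta> \<epsilon> (z k)" if "1 \<le> k" "enat k \<le> T" "int k \<le> M" for k
    using that unfolding M_def by blast
  have a_pos: "a > 0"
    unfolding a_def using \<eta>1 \<rho>1 \<epsilon> \<gamma>(3) by (intro divide_pos_pos mult_pos_pos) auto
  have step: "\<exists>m n. progress a (Suc k) m n" if prog: "progress a k m n" and "int k \<le> M" for k m n
  proof -
    have k: "1 \<le> k" "enat k \<le> T" and "\<Theta> (z k) + n * a \<le> \<Theta> (z 1)"
      using prog by (auto simp: progress_def)
    moreover have "0 \<le> n * a"
      using a_pos by simp
    ultimately have lev: "\<Theta> (z k) \<le> \<Theta> (z 1)"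
      by linarith
    note stationary = stationary_if_small_step[OF lev progress_rho_ge[OF prog]
        progress_rho_le[OF prog \<gamma>(4,5)] \<gamma>(1-3)]
    have "\<Phi> (z k) (\<rho> k) (s k) \<noteq> \<Theta> (z k)"
    proof
      assume eq: "\<Phi> (z k) (\<rho> k) (s k) = \<Theta> (z k)"
      \<comment> \<open>At termination the model value at 0 equals the minimal one, so the zero step
        meets the hypotheses and is trivially small.\<close>
      have "approx_d_stationary \<Theta> \<epsilon> (z k)"
        using run_minimal[OF k] \<epsilon> eq by (intro stationary[of 0]) (auto simp: \<Phi>_0)
      then show False
        using none k that by blast
    qed
    moreover have "a \<le> \<eta>1 * \<rho> 1 / 2 * (norm (s k))\<^sup>2"
    proof (rule ccontr)
      assume "\<not> ?thesis"
      then have "\<eta>1 * \<rho> 1 / 2 * (norm (s k))\<^sup>2 \<le> \<eta>1 * \<rho> 1 / 2 * (\<epsilon>\<^sup>2 / (3 * \<gamma>\<^sup>2))"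
        by (simp add: a_def)
      then have "(norm (s k))\<^sup>2 \<le> \<epsilon>\<^sup>2 / (3 * \<gamma>\<^sup>2)"
        by (rule mult_left_le_imp_le) (use \<eta>1 \<rho>1 in simp)
      then have "3 * \<gamma>\<^sup>2 * (norm (s k))\<^sup>2 \<le> \<epsilon>\<^sup>2"
        using \<gamma>(3) by (simp add: field_simps)
      then have "approx_d_stationary \<Theta> \<epsilon> (z k)"
        using run_minimal[OF k] run_step_le[OF k] \<epsilon> by (intro stationary[of "s k"])
      then show False
        using none k that by blast
    qed
    ultimately show ?thesis
      using progress_Suc[OF prog] a_pos by simp
  qed
  \<comment> \<open>Runs start at index 1, so \<open>k\<close> non-stationary iterates lead to
    iteration \<open>Suc k\<close>; for \<open>k = M\<close> the run is still alive one step past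
    the bound.\<close>
  have "\<exists>m n. progress a (Suc k) m n" if "int k \<le> M" for k
    using that
  proof (induction k)
    case 0
    then show ?case
      using progress_1 by (metis One_nat_def)
  next
    case (Suc k)
    then obtain m n where "progress a (Suc k) m n"
      by auto
    then show ?case
      using step Suc.prems by blast
  qed
  moreover
  have \<Delta>_nonneg: "0 \<le> 6 * \<gamma>\<^sup>2 / (\<eta>1 * \<rho> 1) * (\<Theta> (z 1) - \<Theta>star) / \<epsilon>\<^sup>2"
    using \<eta>1 \<rho>1 \<Theta>star_le[of "z 1"] by (intro divide_nonneg_nonneg mult_nonneg_nonneg) auto
  have "0 \<le> real_of_int M"
    unfolding M_def by (rule order_trans[OF _ le_of_int_ceiling]) (use \<Delta>_nonneg in \<open>simp add: \<kappa>\<close>)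
  then have "0 \<le> M"
    by simp
  ultimately obtain m n where prog: "progress a (Suc (nat M)) m n"
    by (metis nat_0_le order_refl)
  then have "nat M = m + n"
    unfolding progress_def by blast
  then have "M = int m + int n"
    using \<open>0 \<le> M\<close> by linarith
  moreover have "\<kappa> + 6 * \<gamma>\<^sup>2 / (\<eta>1 * \<rho> 1) * (\<Theta> (z 1) - \<Theta>star) / \<epsilon>\<^sup>2 \<le> real_of_int M"
    unfolding M_def by (rule le_of_int_ceiling)
  \<comment> \<open>The summand 1 in \<kappa> is the slack that makes the lower bound on
    \<open>n\<close> below strict. So many accepted steps would exceed the total possible
    decrease.\<close>
  moreover have "real_of_int (int m) \<le> \<kappa> - 1"
    using progress_rejected_le[OF prog] unfolding \<kappa>
    by (metis add_diff_cancel_right' of_int_0 of_int_le_iff of_int_max)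
  ultimately have "6 * \<gamma>\<^sup>2 / (\<eta>1 * \<rho> 1) * (\<Theta> (z 1) - \<Theta>star) / \<epsilon>\<^sup>2 < real n"
    by simp
  then have "6 * \<gamma>\<^sup>2 / (\<eta>1 * \<rho> 1) * (\<Theta> (z 1) - \<Theta>star) / \<epsilon>\<^sup>2 * a < real n * a"
    using a_pos by (rule mult_strict_right_mono)
  moreover have "6 * \<gamma>\<^sup>2 / (\<eta>1 * \<rho> 1) * (\<Theta> (z 1) - \<Theta>star) / \<epsilon>\<^sup>2 * a = \<Theta> (z 1) - \<Theta>star"
    using \<eta>1 \<rho>1 \<epsilon> \<gamma>(3) by (simp add: a_def)
  moreover have "real n * a \<le> \<Theta> (z 1) - \<Theta>star"
    using prog \<Theta>star_le[of "z (Suc (nat M))"] unfolding progress_def by linarith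
  ultimately show False
    by linarith
qed

end

section \<open>Verifying the abstract setting for the layered problem\<close>

section \<open>The penalized problem\<close>

lemma locally_lipschitz_imp_continuous_on:
  assumes "locally_lipschitz f"
  shows "continuous_on UNIV f"
proof -
  have "isCont f x" for x
  proof -
    obtain e K where "e > 0" "K-lipschitz_on (ball x e) f"
      using assms unfolding locally_lipschitz_def by blast
    then show ?thesis
      using lipschitz_on_continuous_on[of K "ball x e" f]
      by (auto simp: continuous_on_eq_continuous_at)
  qed
  then show ?thesis
    by (simp add: continuous_at_imp_continuous_on)
qed

lemma obj_F_GDERIV:
  assumes "smooth_fun g"
  shows "GDERIV (obj_F g lam) x :> ((2 * lam) *\<^sub>R fst x, grad g (snd x))"
proof -
  have "(g has_derivative (\<lambda>h. h \<bullet> grad g (snd x))) (at (snd x))"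
    using smooth_fun_GDERIV[OF assms] by (simp add: gderiv_def)
  moreover have "(snd has_derivative snd) (at x)"
    by (auto intro!: derivative_eq_intros)
  ultimately have "((\<lambda>x. g (snd x)) has_derivative (\<lambda>h. snd h \<bullet> grad g (snd x))) (at x)"
    by (rule has_derivative_compose[rotated])
  then have "((\<lambda>x. g (snd x) + lam * (fst x \<bullet> fst x)) has_derivative
      (\<lambda>h. snd h \<bullet> grad g (snd x) + lam * (fst x \<bullet> fst h + fst h \<bullet> fst x))) (at x)"
    by (auto intro!: derivative_eq_intros)
  then show ?thesis
    unfolding gderiv_def
    by (simp add: obj_F_def[abs_def] power2_norm_eq_inner inner_prod_def inner_commute algebra_simps)
qed

lemma part_c_GDERIV:
  assumes "smooth_fun (\<psi> j)"
  shows "\<exists>D. GDERIV (part_c lay \<beta> \<psi> j) x :> D"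
proof -
  have "GDERIV (\<lambda>z. snd z $ j) x :> (0, axis j 1)"
    unfolding gderiv_def
    by (rule has_derivative_eq_rhs,
        rule bounded_linear_imp_has_derivative,
        rule bounded_linear_compose[OF bounded_linear_vec_nth bounded_linear_snd])
      (simp add: fun_eq_iff inner_prod_def inner_axis)
  from GDERIV_cmult[OF GDERIV_diff[OF this smooth_fun_GDERIV[OF assms]], of "\<beta> (lay j)"]
  show ?thesis
    unfolding part_c_def[abs_def] by blast
qed

theorem theorem3p4:
  fixes L I :: nat
    and lay :: "'m::finite \<Rightarrow> nat"
    and g :: "real^'m \<Rightarrow> real"
    and \<psi> :: "'m \<Rightarrow> (real^'n::finite) \<times> (real^'m) \<Rightarrow> real"
    and lam :: real
    and \<beta> :: "nat \<Rightarrow> real"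
    and F \<Theta> H :: "(real^'n) \<times> (real^'m) \<Rightarrow> real"
    and \<J> :: "'m set"
    and c :: "'m \<Rightarrow> (real^'n) \<times> (real^'m) \<Rightarrow> real"
    and J :: nat
    and \<Theta>star :: real
    and P :: "nat \<Rightarrow> ((real^'n) \<times> (real^'m)) set"
    and z s :: "nat \<Rightarrow> (real^'n) \<times> (real^'m)"
    and ss :: "nat \<Rightarrow> nat \<Rightarrow> (real^'n) \<times> (real^'m)"
    and \<rho> :: "nat \<Rightarrow> real"
    and T :: enat
    and \<eta>1 \<eta>2 \<delta> KF KFbar Kcbar \<gamma> \<kappa>1 \<epsilon> :: real
    and kbar :: int
  assumes layers: "range lay = {1..L}"
    and \<psi>_layered: "\<And>i \<theta> u v. (\<forall>j. lay j < lay i \<longrightarrow> u $ j = v $ j) \<Longrightarrow> \<psi> i (\<theta>, u) = \<psi> i (\<theta>, v)"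
    and g_nonneg: "\<And>u. g u \<ge> 0"
    and g_reg: "locally_lipschitz g" "twice_dir_differentiable g"
    and \<psi>_reg: "\<And>i. locally_lipschitz (\<psi> i)" "\<And>i. twice_dir_differentiable (\<psi> i)"
    and g_smooth: "smooth_fun g"
    and \<psi>_cases: "\<And>i. smooth_fun (\<psi> i) \<or> piecewise_affine (\<psi> i)"
    and lam: "lam > 0"
    and \<beta>: "\<And>l. l \<in> {1..L} \<Longrightarrow> \<beta> l > 0"
    and F: "F = obj_F g lam"
    and \<Theta>: "\<Theta> = obj_Theta L lay \<beta> \<psi> F"
    and H: "H = part_H lay \<beta> \<psi>"
    and \<J>: "\<J> = idx_J \<psi>"
    and c: "c = part_c lay \<beta> \<psi>"
    and J: "J = card \<J>"
    and P_poly: "\<And>i. i \<in> {1..I} \<Longrightarrow> polyhedron (P i) \<and> P i \<noteq> {}"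
    and P_distinct: "inj_on P {1..I}"
    and P_cover: "(\<Union>i\<in>{1..I}. P i) = UNIV"
    and H_affine: "\<And>i. i \<in> {1..I} \<Longrightarrow> affine_fun_on (P i) H"
    and level_bounded: "\<And>a. bounded {x. \<Theta> x \<le> a}"
    and \<Theta>star: "\<Theta>star \<in> range \<Theta>" "\<And>x. \<Theta>star \<le> \<Theta> x"
    and params: "\<rho> 1 > 0" "0 < \<eta>1" "\<eta>1 < 1" "\<eta>2 > 1" "\<delta> > 0"
    and run: "srpa_run \<Theta> F H \<J> c I P \<eta>1 \<eta>2 \<delta> z \<rho> ss s T"
    and KF: "KF > 0" "\<And>x. \<Theta> x \<le> \<Theta> (z 1) \<Longrightarrow> norm (grad F x) \<le> KF"
    and K_pos: "KFbar > 0" "Kcbar > 0"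
    and K_lip:
      "\<forall>x \<in> {x + b |x b. \<Theta> x \<le> \<Theta> (z 1) \<and> b \<in> cball 0 (2 * KF / \<rho> 1 + sqrt (2 * \<Theta> (z 1) / \<rho> 1))}.
       \<forall>y \<in> {x + b |x b. \<Theta> x \<le> \<Theta> (z 1) \<and> b \<in> cball 0 (2 * KF / \<rho> 1 + sqrt (2 * \<Theta> (z 1) / \<rho> 1))}.
         norm (grad F x - grad F y) \<le> KFbar * norm (x - y) \<and>
         onorm (\<lambda>w. jac_T \<J> c x w - jac_T \<J> c y w) \<le> Kcbar * norm (x - y)"
    and \<gamma>: "\<gamma> = Max {2 * (\<Theta> (z 1) - \<Theta>star) / (sqrt (2 * \<Theta> (z 1) / \<rho> 1) + 2 * KF / \<rho> 1)\<^sup>2,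
                  8 * (\<Theta> (z 1) - \<Theta>star) / \<delta>\<^sup>2,
                  \<rho> 1 * \<eta>2 + 2 * (KFbar + sqrt (real J) * Kcbar),
                  (\<eta>2\<^sup>2 / (1 - \<eta>1) + 2) * (KFbar + sqrt (real J) * Kcbar),
                  1}"
    and \<kappa>1: "\<kappa>1 = max 0 (real_of_int \<lceil>log \<eta>2 ((KFbar + sqrt (real J) * Kcbar) / (\<rho> 1 * (1 - \<eta>1)))\<rceil>) + 1"
    and kbar: "kbar = \<lceil>\<kappa>1 + 6 * \<gamma>\<^sup>2 / (\<eta>1 * \<rho> 1) * (\<Theta> (z 1) - \<Theta>star) / \<epsilon>\<^sup>2\<rceil>"
    and \<epsilon>: "\<epsilon> > 0"
  shows "\<exists>k\<ge>1. enat k \<le> T \<and> int k \<le> kbar \<and> approx_d_stationary \<Theta> \<epsilon> (z k)"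
proof -
  have lay_in: "lay i \<in> {1..L}" for i
    using layers by auto
  have \<beta>_pos: "\<beta> (lay i) > 0" for i
    using \<beta> lay_in by blast
  \<comment> \<open>Every coordinate lies in exactly one block, so the double sum over blocks
    collapses to a sum over coordinates.\<close>
  have \<Theta>_sum: "\<Theta> x = F x + (\<Sum>i\<in>UNIV. \<beta> (lay i) * \<bar>snd x $ i - \<psi> i x\<bar>)" for x
  proof -
    have "(\<Sum>l=1..L. \<beta> l * (\<Sum>i | lay i = l. \<bar>snd x $ i - \<psi> i x\<bar>))
        = (\<Sum>l=1..L. \<Sum>i | i \<in> UNIV \<and> lay i = l. \<beta> (lay i) * \<bar>snd x $ i - \<psi> i x\<bar>)"
      by (simp add: sum_distrib_left)
    also have "\<dots> = (\<Sum>i\<in>UNIV. \<beta> (lay i) * \<bar>snd x $ i - \<psi> i x\<bar>)"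
      using lay_in by (intro sum.group) auto
    finally show ?thesis
      by (simp add: \<Theta> obj_Theta_def)
  qed
  \<comment> \<open>The coordinates are sorted by whether their \<psi> is piecewise affine;
    positivity of the weights moves them inside the absolute values of the
    \<open>c j\<close>.\<close>
  have split: "\<Theta> x = F x + H x + (\<Sum>j\<in>\<J>. \<bar>c j x\<bar>)" for x
  proof -
    have "(\<Sum>i\<in>UNIV. \<beta> (lay i) * \<bar>snd x $ i - \<psi> i x\<bar>)
        = (\<Sum>i | piecewise_affine (\<psi> i). \<beta> (lay i) * \<bar>snd x $ i - \<psi> i x\<bar>)
        + (\<Sum>i | \<not> piecewise_affine (\<psi> i). \<beta> (lay i) * \<bar>snd x $ i - \<psi> i x\<bar>)"
      by (subst sum.union_disjoint[symmetric]) (auto intro: sum.cong)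
    then show ?thesis
      using \<beta>_pos by (simp add: \<Theta>_sum H part_H_def c part_c_def \<J> idx_J_def abs_mult abs_of_pos)
  qed
  have cont: "continuous_on UNIV \<Theta>"
  proof -
    have "continuous_on UNIV (\<lambda>x. g (snd x) :: real)"
      by (rule continuous_on_compose2[OF locally_lipschitz_imp_continuous_on[OF g_reg(1)]
            continuous_on_snd[OF continuous_on_id]]) simp
    then show ?thesis
      unfolding \<Theta>_sum[abs_def] F obj_F_def
      by (intro continuous_intros locally_lipschitz_imp_continuous_on[OF \<psi>_reg(1)])
  qed
  have dir: "\<exists>D. has_dir_deriv \<Theta> x d D" for x d
  proof -
    obtain Dg where Dg: "has_dir_deriv g (snd x) (snd d) Dg"
      using g_reg(2) unfolding twice_dir_differentiable_def by blast
    have "has_dir_deriv (\<lambda>x. g (snd x)) x d Dg"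
      using Dg by (simp add: has_dir_deriv_def)
    from has_dir_deriv_add[OF this has_dir_deriv_cmult[OF has_dir_deriv_norm_sq[OF linear_fst]]]
    obtain DF where DF: "has_dir_deriv F x d DF"
      unfolding F obj_F_def[abs_def] by blast
    have "\<forall>i. \<exists>E. has_dir_deriv (\<lambda>x. \<beta> (lay i) * \<bar>snd x $ i - \<psi> i x\<bar>) x d E"
    proof
      fix i
      obtain D where "has_dir_deriv (\<psi> i) x d D"
        using \<psi>_reg(2) unfolding twice_dir_differentiable_def by blast
      from has_dir_deriv_cmult[OF this, of "-1"]
      have neg: "has_dir_deriv (\<lambda>x. - \<psi> i x) x d (- D)"
        by simp
      have "\<forall>\<^sub>F t in at_right 0. snd d $ i = (snd (x + t *\<^sub>R d) $ i - snd x $ i) / t"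
        using eventually_at_right_less[of 0] by eventually_elim simp
      then have "has_dir_deriv (\<lambda>x. snd x $ i) x d (snd d $ i)"
        unfolding has_dir_deriv_def by (rule Lim_transform_eventually[OF tendsto_const])
      from has_dir_deriv_abs[OF has_dir_deriv_add[OF this neg]]
      show "\<exists>E. has_dir_deriv (\<lambda>x. \<beta> (lay i) * \<bar>snd x $ i - \<psi> i x\<bar>) x d E"
        using has_dir_deriv_cmult by fastforce
    qed
    from choice[OF this] obtain E where
      E: "\<And>i. has_dir_deriv (\<lambda>x. \<beta> (lay i) * \<bar>snd x $ i - \<psi> i x\<bar>) x d (E i)"
      by blast
    have "has_dir_deriv (\<lambda>x. \<Sum>i\<in>UNIV. \<beta> (lay i) * \<bar>snd x $ i - \<psi> i x\<bar>) x d (\<Sum>i\<in>UNIV. E i)"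
      by (rule has_dir_deriv_sum) (rule E)
    from has_dir_deriv_add[OF DF this] show ?thesis
      unfolding \<Theta>_sum[abs_def] by (rule exI)
  qed
  define R where "R = 2 * KF / \<rho> 1 + sqrt (2 * \<Theta> (z 1) / \<rho> 1)"
  define q where "q = KFbar + sqrt (real (card \<J>)) * Kcbar"
  have F_nonneg: "F x \<ge> 0" for x
    using lam g_nonneg by (simp add: F obj_F_def)
  have H_nonneg: "H x \<ge> 0" for x
    unfolding H part_H_def using \<beta>_pos by (intro sum_nonneg) (simp add: less_imp_le)
  have "\<Theta> (z 1) \<ge> 0"
    unfolding split by (intro add_nonneg_nonneg F_nonneg H_nonneg sum_nonneg abs_ge_zero)
  then have R_pos: "R > 0"
    using KF(1) params(1) by (simp add: R_def add_pos_nonneg)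
  have lip: "norm (grad F (x + v) - grad F x) \<le> KFbar * norm v \<and>
      onorm (\<lambda>w. jac_T \<J> c (x + v) w - jac_T \<J> c x w) \<le> Kcbar * norm v"
    if "\<Theta> x \<le> \<Theta> (z 1)" "norm v \<le> R" for x v
  proof -
    let ?X = "{x + b |x b. \<Theta> x \<le> \<Theta> (z 1) \<and> b \<in> cball 0 R}"
    \<comment> \<open>Both points lie in the enlarged level set, with ball components
      \<open>v\<close> and 0.\<close>
    have "x + v \<in> ?X"
      by (intro CollectI exI[of _ x] exI[of _ v]) (use that in simp)
    moreover have "x \<in> ?X"
      by (intro CollectI exI[of _ x] exI[of _ 0]) (use that R_pos in simp)
    ultimately have "norm (grad F (x + v) - grad F x) \<le> KFbar * norm (x + v - x) \<and>
        onorm (\<lambda>w. jac_T \<J> c (x + v) w - jac_T \<J> c x w) \<le> Kcbar * norm (x + v - x)"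
      using K_lip[folded R_def] by blast
    then show ?thesis
      by simp
  qed
  interpret srpa \<Theta> F H \<J> c I P \<eta>1 \<eta>2 \<delta> z s \<rho> ss T KF KFbar Kcbar \<Theta>star R q
  proof unfold_locales
    show "\<exists>D. GDERIV F x :> D" for x
      unfolding F using obj_F_GDERIV[OF g_smooth] by blast
    \<comment> \<open>An index in \<open>\<J>\<close> is not piecewise affine, so
      \<open>\<psi>_cases\<close> makes its component smooth.\<close>
    show "\<exists>D. GDERIV (c j) x :> D" if "j \<in> \<J>" for j x
      unfolding c using that \<psi>_cases[of j] by (intro part_c_GDERIV) (simp add: \<J> idx_J_def)
  qed (use split F_nonneg H_nonneg cont dir level_bounded \<Theta>star(2) P_cover params run KF K_pos lip
      in \<open>auto simp: R_def q_def\<close>)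
  have \<gamma>_ge: "2 * (\<Theta> (z 1) - \<Theta>star) / R\<^sup>2 \<le> \<gamma>" "8 * (\<Theta> (z 1) - \<Theta>star) / \<delta>\<^sup>2 \<le> \<gamma>"
    "\<rho> 1 * \<eta>2 + 2 * q \<le> \<gamma>" "(\<eta>2\<^sup>2 / (1 - \<eta>1) + 2) * q \<le> \<gamma>" "1 \<le> \<gamma>"
    unfolding \<gamma> R_def q_def J by (intro Max_ge; simp add: add.commute)+
  show ?thesis
    unfolding kbar
  proof (rule complexity)
    show "2 * (\<Theta> (z 1) - \<Theta>star) \<le> \<gamma> * R\<^sup>2"
      using \<gamma>_ge(1) R_pos by (simp add: divide_le_eq)
    show "8 * (\<Theta> (z 1) - \<Theta>star) \<le> \<gamma> * \<delta>\<^sup>2"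
      using \<gamma>_ge(2) params(5) by (simp add: divide_le_eq)
    show "\<kappa>1 = max 0 (real_of_int \<lceil>log \<eta>2 (q / (\<rho> 1 * (1 - \<eta>1)))\<rceil>) + 1"
      unfolding \<kappa>1 q_def J ..
  qed (use \<gamma>_ge \<epsilon> in auto)
qed

end
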